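(* Let $W$ be a lower-bounded generalized $g$-twisted $V$-module. Let $\{\phi^i(x)\}_{i\in I}$ be a set of generating fields of $V$ and $\{\psi_W^a(x)\}_{a\in A}$ a set of generator twist fields of $W$. Then $W$ is spanned by the elements $$(\psi_W^a)_{n,k}\phi^{i_1}_{n_1}\cdots\phi^{i_l}_{n_l}\mathbf 1$$ for $a\in A$, $i_1,\dots,i_l\in I$, $n\in\alpha^{i_1}+\cdots+\alpha^{i_l}+\mathbb Z$, $k\in\mathbb N$, $n_1,\dots,n_{l-1}\in\mathbb Z$, $n_l\in-\mathbb N-1$.
   Context: $\mathbb N=\{0,1,2,\dots\}$. $V$ is a grading-restricted vertex superalgebra: a $\frac12\mathbb Z\times\mathbb Z_2$-graded complex vector space (weight $\mathrm{wt}$, fermion number $|\cdot|$) $V=\coprod_n V_{(n)}$ with $\dim V_{(n)}<\infty$, $V_{(n)}=0$ for $n$ sufficiently negative, an even vacuum $\mathbf 1\in V_{(0)}$, an even map $Y_V:V\otimes V\to V((x))$, operators $L_V(0)$ (equal to $n$ on $V_{(n)}$) and $L_V(-1)$, satisfying the vacuum and creation properties, the super Jacobi identity, $[L_V(0),Y_V(v,x)]=x\frac{d}{dx}Y_V(v,x)+Y_V(L_V(0)v,x)$ and $\frac{d}{dx}Y_V(v,x)=Y_V(L_V(-1)v,x)=[L_V(-1),Y_V(v,x)]$. $g$ is an automorphism of $V$ (bijection preserving gradings, $\mathbf 1$, $Y_V$, commuting with $L_V(-1)$). $P_V=\{\alpha\in\mathbb C:0\le\Re\alpha<1,\ e^{2\pi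 i\alpha}\text{ is an eigenvalue of }g\}$, $V^{[\alpha]}$ is the generalized $e^{2\pi i\alpha}$-eigenspace, $V=\coprod_{\alpha\in P_V}V^{[\alpha]}$, $g=e^{2\pi i\mathcal L_g}$ with $\mathcal L_g=\mathcal S_g+\mathcal N_g$, $\mathcal S_g=\alpha$ on $V^{[\alpha]}$ and $\mathcal N_g$ (locally) nilpotent. A lower-bounded generalized $g$-twisted $V$-module is $W=\coprod_{n\in\mathbb C,s\in\mathbb Z_2,[\alpha]\in\mathbb C/\mathbb Z}W^{s;[\alpha]}_{[n]}$ (weight, fermion number, $g$-weight), $W_{[n]}=0$ for $\Re n$ sufficiently negative, with an action of $g=e^{2\pi i\mathcal L_g}$, $\mathcal L_g=\mathcal S_g+\mathcal N_g$ (semisimple and nilpotent parts), $W^{[\alpha]}$ being the generalized $e^{2\pi i\alpha}$-eigenspace of $g$; operators $L_W(0)$, $L_W(-1)$, $W_{[n]}$ being the generalized $n$-eigenspace of $L_W(0)$, $[L_W(0),L_W(-1)]=L_W(-1)$; and an even linear map $Y^g_W:V\otimes W\to W\{x\}[\log x]$, $Y_W^g(v,x)w=\sum_{n\in\mathbb C,k\in\mathbb N}(Y_W^g)_{n,k}(v)w\,x^{-n-1}(\log x)^k$, such that: $Y_W^g(\mathbf 1,x)=1_W$; $gY_W^g(v,x)w=Y_W^g(gv,x)gw$; $[L_W(0),Y_W^g(v,x)]=x\frac{d}{dx}Y_W^g(v,x)+Y_W^g(L_V(0)v,x)$; $\frac{d}{dx}Y_W^g(v,x)=Y_W^g(L_V(-1)v,x)=[L_W(-1),Y_W^g(v,x)]$;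 equivariance $(Y^g_W)^{p+1}(gv,z)=(Y_W^g)^p(v,z)$, where $(Y_W^g)^p(v,z)$ ($p\in\mathbb Z$, $z\in\mathbb C^\times$) is obtained by $x^n\mapsto e^{nl_p(z)}$, $\log x\mapsto l_p(z)=\log|z|+i\arg z+2\pi ip$, $0\le\arg z<2\pi$; duality: for $u,v\in V$, $w\in W$, $w'\in W'$ (graded dual) there is $f=\sum a_{ijkl}z_1^{m_i}z_2^{n_j}(\log z_1)^k(\log z_2)^l(z_1-z_2)^{-t}$ (finite sum) such that $\langle w',(Y_W^g)^p(u,z_1)(Y_W^g)^p(v,z_2)w\rangle$, $(-1)^{|u||v|}\langle w',(Y_W^g)^p(v,z_2)(Y_W^g)^p(u,z_1)w\rangle$, $\langle w',(Y_W^g)^p(Y_V(u,z_1-z_2)v,z_2)w\rangle$ converge absolutely for $|z_1|>|z_2|>0$, $|z_2|>|z_1|>0$, $|z_2|>|z_1-z_2|>0$ respectively, to the branch of $f$ given by $\log z_j=l_p(z_j)$ (for the third, when $|\arg z_1-\arg z_2|<\pi/2$). $W$ is generated by a subset $S$ if $W$ is spanned by the coefficients of $Y_W^g(v,x)L_W(-1)^pL_W(0)^qw$, $v\in V$, $p,q\in\mathbb N$, $w\in S$. Generating fields of $V$: $\phi^i(x)=Y_V(\phi^i_{-1}\mathbf 1,x)=\sum_{n\in\mathbb Z}\phi^i_nx^{-n-1}$, $i\in I$, with the $\phi^{i_1}_{m_1}\cdots\phi^{i_l}_{m_l}\mathbf 1$ spanning $V$; each $\phi^i_{-1}\mathbf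 1$ is homogeneous in weight and fermion number, lies in $V^{[\alpha^i]}$, $\alpha^i\in P_V$, and $\mathcal N_g\phi^i_{-1}\mathbf 1$ is $0$ or equals $\phi^{\mathcal N_g(i)}_{-1}\mathbf 1$ for some $\mathcal N_g(i)\in I$. Twist vertex operators: for $w\in W$, $v\in V$ (homogeneous in fermion number), $(Y^g)^W_{WV}(w,x)v=(-1)^{|v||w|}e^{xL_W(-1)}Y_W^g(v,y)w\big|_{y^n=e^{\pi in}x^n,\ \log y=\log x+\pi i}$. A set of generator twist fields of $W$ is a set $\psi_W^a(x)=(Y^g)^W_{WV}(w^a,x)$, $a\in A$, where the $w^a=(\psi_W^a)_{-1,0}\mathbf 1$ are homogeneous in weight, fermion number and $g$-weight, generate $W$, and satisfy $L_W(0)_Nw^a=0$ or $L_W(0)_Nw^a=w^{L_W(0)_N(a)}$ for some $L_W(0)_N(a)\in A$ ($L_W(0)_N$ the nilpotent part of $L_W(0)$). For $v\in V^{[\alpha]}$, $\psi_W^a(x)v=\sum_{k\in\mathbb N}\sum_{n\in\alpha+\mathbb Z}(\psi_W^a)_{n,k}v\,x^{-n-1}(\log x)^k$. *)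

theory Defs
  imports "HOL-Analysis.Analysis" "HOL-Library.Z2" "HOL-Library.Groups_Big_Fun"
begin

text \<open>
  Complex vector spaces are whole types with an explicit scalar multiplication \<open>s\<close>, as in
  \<^locale>\<open>vector_space\<close>. The group of parities is \<^typ>\<open>bit\<close>.
  \<^const>\<open>Sum_any\<close> is the sum of a finitely supported family; wherever it occurs
  below, finiteness of the support follows from the other axioms.
\<close>

section \<open>Graded spaces and operators\<close>

definition koszul :: "bit \<Rightarrow> bit \<Rightarrow> complex" where
  "koszul s t = (if s = 1 \<and> t = 1 then -1 else 1)"

definition decomposes ::
  "('i \<Rightarrow> 'b::ab_group_add set) \<Rightarrow> 'b \<Rightarrow> ('i \<Rightarrow> 'b) \<Rightarrow> bool" where
  "decomposes C v f \<longleftrightarrow> (\<forall>i. f i \<in> C i) \<and> finite {i. f i \<noteq> 0} \<and> v = Sum_any f"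

definition graded_space ::
  "(complex \<Rightarrow> 'b \<Rightarrow> 'b) \<Rightarrow> ('i \<Rightarrow> 'b::ab_group_add set) \<Rightarrow> bool" where
  "graded_space s C \<longleftrightarrow> (\<forall>i. module.subspace s (C i)) \<and> (\<forall>v. \<exists>!f. decomposes C v f)"

definition component :: "('i \<Rightarrow> 'b::ab_group_add set) \<Rightarrow> 'b \<Rightarrow> 'i \<Rightarrow> 'b" where
  "component C v = (THE f. decomposes C v f)"

definition gen_eigenspace ::
  "(complex \<Rightarrow> 'b \<Rightarrow> 'b) \<Rightarrow> ('b \<Rightarrow> 'b) \<Rightarrow> complex \<Rightarrow> 'b::ab_group_add set" where
  "gen_eigenspace s f c = {v. \<exists>k. ((\<lambda>u. f u - s c u) ^^ k) v = 0}"

definition wt_space ::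
  "(complex \<Rightarrow> 'b \<Rightarrow> 'b) \<Rightarrow> (complex \<Rightarrow> bit \<Rightarrow> 'b::ab_group_add set) \<Rightarrow> complex \<Rightarrow> 'b set" where
  "wt_space s G h = module.span s (\<Union>t. G h t)"

definition par_space ::
  "(complex \<Rightarrow> 'b \<Rightarrow> 'b) \<Rightarrow> (complex \<Rightarrow> bit \<Rightarrow> 'b::ab_group_add set) \<Rightarrow> bit \<Rightarrow> 'b set" where
  "par_space s G t = module.span s (\<Union>h. G h t)"

text \<open>The fermion number of an element that is homogeneous in fermion number.\<close>

definition parity ::
  "(complex \<Rightarrow> 'b \<Rightarrow> 'b) \<Rightarrow> (complex \<Rightarrow> bit \<Rightarrow> 'b::ab_group_add set) \<Rightarrow> 'b \<Rightarrow> bit" where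
  "parity s G v = (if v \<in> par_space s G 0 then 0 else 1)"

text \<open>Representatives of the classes in \<open>\<complex>/\<int>\<close>.\<close>

definition strip :: "complex set" where
  "strip = {\<alpha>. 0 \<le> Re \<alpha> \<and> Re \<alpha> < 1}"

abbreviation e2pi :: "complex \<Rightarrow> complex" where
  "e2pi \<alpha> \<equiv> exp (2 * of_real pi * \<i> * \<alpha>)"

text \<open>
  \<open>g = exp (2 \<pi> \<i> (S + N))\<close> where \<open>S\<close> is \<open>\<alpha>\<close> on the generalized
  \<open>exp (2 \<pi> \<i> \<alpha>)\<close>-eigenspace of \<open>g\<close> and \<open>N\<close> is locally nilpotent and commutes with
  \<open>S\<close>. On that eigenspace the exponential is the factor
  \<open>exp (2 \<pi> \<i> \<alpha>)\<close> times a locally finite power series in \<open>N\<close>. When the generalized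
  eigenspaces span, as they do for \<open>V\<close> and \<open>W\<close> below, this determines \<open>S\<close> and \<open>N\<close>.
\<close>

locale log_operator = vector_space s
  for s :: "complex \<Rightarrow> 'b::ab_group_add \<Rightarrow> 'b" +
  fixes g S N :: "'b \<Rightarrow> 'b"
  assumes S_linear: "Vector_Spaces.linear s s S"
    and N_linear: "Vector_Spaces.linear s s N"
    and S_semisimple: "\<alpha> \<in> strip \<Longrightarrow> v \<in> gen_eigenspace s g (e2pi \<alpha>) \<Longrightarrow> S v = s \<alpha> v"
    and N_nilpotent: "\<exists>k. (N ^^ k) v = 0"
    and S_N_commute: "S (N v) = N (S v)"
    and g_exp: "\<alpha> \<in> strip \<Longrightarrow> v \<in> gen_eigenspace s g (e2pi \<alpha>) \<Longrightarrow>
      g v = s (e2pi \<alpha>) (Sum_any (\<lambda>j::nat. s ((2 * of_real pi * \<i>) ^ j / fact j) ((N ^^ j) v)))"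

section \<open>Grading-restricted vertex superalgebras and their automorphisms\<close>

text \<open>
  \<open>YV u n v\<close> is the coefficient of \<open>x^(-n-1)\<close> in \<open>Y_V(u,x)v\<close>, and \<open>Vgr h s\<close> the
  subspace of weight \<open>h\<close> and fermion number \<open>s\<close>. The axiom \<open>jacobi\<close> is the coefficient
  of \<open>x0^(-l-1) x1^(-m-1) x2^(-n-1)\<close> in the super Jacobi identity, with all binomials
  expanded in nonnegative powers of their second variable.
\<close>

locale grading_restricted_vertex_superalgebra = V: vector_space sV
  for sV :: "complex \<Rightarrow> 'v::ab_group_add \<Rightarrow> 'v" +
  fixes Vgr :: "complex \<Rightarrow> bit \<Rightarrow> 'v set"
    and YV :: "'v \<Rightarrow> int \<Rightarrow> 'v \<Rightarrow> 'v"
    and vac :: 'v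
    and L0V LmV :: "'v \<Rightarrow> 'v"
  assumes V_graded: "graded_space sV (\<lambda>(h, s). Vgr h s)"
    and V_half_integral: "2 * h \<notin> \<int> \<Longrightarrow> Vgr h s = {0}"
    and V_finite_dim: "\<exists>B. finite B \<and> wt_space sV Vgr h \<subseteq> V.span B"
    and V_lower_bounded: "\<exists>b. \<forall>h. Re h < b \<longrightarrow> wt_space sV Vgr h = {0}"
    and YV_linear_left: "Vector_Spaces.linear sV sV (\<lambda>u. YV u n v)"
    and YV_linear_right: "Vector_Spaces.linear sV sV (YV u n)"
    and YV_lower_truncated: "\<exists>m. \<forall>n\<ge>m. YV u n v = 0"
    and YV_even: "u \<in> par_space sV Vgr s \<Longrightarrow> v \<in> par_space sV Vgr t \<Longrightarrow>
      YV u n v \<in> par_space sV Vgr (s + t)"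
    and vac_homogeneous: "vac \<in> Vgr 0 0"
    and vacuum: "YV vac n v = (if n = -1 then v else 0)"
    and creation: "n \<ge> 0 \<Longrightarrow> YV v n vac = 0" "YV v (-1) vac = v"
    and L0V_linear: "Vector_Spaces.linear sV sV L0V"
    and L0V_grading: "v \<in> wt_space sV Vgr h \<Longrightarrow> L0V v = sV h v"
    and LmV_linear: "Vector_Spaces.linear sV sV LmV"
    and jacobi: "u \<in> par_space sV Vgr s \<Longrightarrow> v \<in> par_space sV Vgr t \<Longrightarrow>
      Sum_any (\<lambda>i::nat. sV ((-1) ^ i * (of_int l gchoose i)) (YV u (m + l - int i) (YV v (n + int i) w)))
      - sV (koszul s t) (Sum_any (\<lambda>i::nat. sV ((-1) powi l * (-1) ^ i * (of_int l gchoose i))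
          (YV v (n + l - int i) (YV u (m + int i) w))))
      = Sum_any (\<lambda>i::nat. sV (of_int m gchoose i) (YV (YV u (l + int i) v) (m + n - int i) w))"
    and L0V_bracket: "L0V (YV u n v) - YV u n (L0V v) = sV (of_int (- n - 1)) (YV u n v) + YV (L0V u) n v"
    and LmV_derivative: "YV (LmV u) n v = sV (of_int (- n)) (YV u (n - 1) v)"
    and LmV_bracket: "LmV (YV u n v) - YV u n (LmV v) = YV (LmV u) n v"

text \<open>
  That \<open>V\<close> is the direct sum of the generalized eigenspaces of \<open>g\<close> follows from
  \<open>V_finite_dim\<close>.
\<close>

locale vertex_superalgebra_automorphism =
  grading_restricted_vertex_superalgebra sV Vgr YV vac L0V LmV + log_operator sV g Sg Ng
  for sV :: "complex \<Rightarrow> 'v::ab_group_add \<Rightarrow> 'v"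
    and Vgr YV vac L0V LmV and g Sg Ng :: "'v \<Rightarrow> 'v" +
  assumes g_linear: "Vector_Spaces.linear sV sV g"
    and g_bij: "bij g"
    and g_grading: "g ` Vgr h s = Vgr h s"
    and g_vac: "g vac = vac"
    and g_YV: "g (YV u n v) = YV (g u) n (g v)"
    and g_LmV: "g (LmV v) = LmV (g v)"

definition g_weights ::
  "(complex \<Rightarrow> 'v \<Rightarrow> 'v) \<Rightarrow> ('v::ab_group_add \<Rightarrow> 'v) \<Rightarrow> complex set" where
  "g_weights s g = {\<alpha> \<in> strip. \<exists>v. v \<noteq> 0 \<and> g v = s (e2pi \<alpha>) v}"

section \<open>Lower-bounded generalized twisted modules\<close>

text \<open>The branch \<open>l_p\<close> of the logarithm, with argument in \<open>[0, 2 \<pi>)\<close> for \<open>p = 0\<close>.\<close>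

definition log_branch :: "int \<Rightarrow> complex \<Rightarrow> complex" where
  "log_branch p z = of_real (ln (norm z)) + \<i> * of_real (Arg2pi z) + 2 * of_real pi * \<i> * of_int p"

text \<open>The value of \<open>x^(-n-1) (log x)^k\<close> at \<open>z\<close> on the branch \<open>p\<close>.\<close>

definition term_value :: "int \<Rightarrow> complex \<Rightarrow> complex \<Rightarrow> nat \<Rightarrow> complex" where
  "term_value p z n k = exp ((- n - 1) * log_branch p z) * log_branch p z ^ k"

text \<open>
  \<open>YW v n k w\<close> is the coefficient of \<open>x^(-n-1) (log x)^k\<close> in \<open>Y_W^g(v,x)w\<close>.
  The following families are the terms of
  \<open>\<langle>w', Y^p(v,z)w\<rangle>\<close>, \<open>\<langle>w', Y^p(u,z1)Y^p(v,z2)w\<rangle>\<close> and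
  \<open>\<langle>w', Y^p(Y_V(u,z1-z2)v,z2)w\<rangle>\<close>, indexed by the powers of the variables; for
  given powers only finitely many powers of the logarithms contribute.
\<close>

type_synonym ('v, 'w) twisted_map = "'v \<Rightarrow> complex \<Rightarrow> nat \<Rightarrow> 'w \<Rightarrow> 'w"

definition vertex_value ::
  "('v, 'w) twisted_map \<Rightarrow> int \<Rightarrow> ('w \<Rightarrow> complex) \<Rightarrow> 'v \<Rightarrow> complex \<Rightarrow> 'w \<Rightarrow> complex" where
  "vertex_value YW p w' v z w = Sum_any (\<lambda>(n, k). w' (YW v n k w) * term_value p z n k)"

definition product_terms ::
  "('v, 'w) twisted_map \<Rightarrow> int \<Rightarrow> ('w \<Rightarrow> complex) \<Rightarrow> 'v \<Rightarrow> complex \<Rightarrow> 'v \<Rightarrow> complex \<Rightarrow> 'w \<Rightarrow>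
    complex \<times> complex \<Rightarrow> complex" where
  "product_terms YW p w' u z1 v z2 w = (\<lambda>(m, n). Sum_any (\<lambda>(k, l).
     w' (YW u m k (YW v n l w)) * term_value p z1 m k * term_value p z2 n l))"

definition iterate_terms ::
  "('v \<Rightarrow> int \<Rightarrow> 'v \<Rightarrow> 'v) \<Rightarrow> ('v, 'w) twisted_map \<Rightarrow> int \<Rightarrow> ('w \<Rightarrow> complex) \<Rightarrow>
    'v \<Rightarrow> complex \<Rightarrow> 'v \<Rightarrow> complex \<Rightarrow> 'w \<Rightarrow> int \<times> complex \<Rightarrow> complex" where
  "iterate_terms YV YW p w' u z1 v z2 w = (\<lambda>(m, n). Sum_any (\<lambda>k.
     w' (YW (YV u m v) n k w) * (z1 - z2) powi (- m - 1) * term_value p z2 n k))"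

text \<open>
  The branch at \<open>log z1 = l_p(z1)\<close>, \<open>log z2 = l_p(z2)\<close> of the sum over \<open>(m,n,k,l) \<in> A\<close> of
  \<open>a(m,n,k,l) z1^m z2^n (log z1)^k (log z2)^l (z1-z2)^(-t)\<close>.
\<close>

definition correlation_branch ::
  "(complex \<times> complex \<times> nat \<times> nat) set \<Rightarrow> (complex \<times> complex \<times> nat \<times> nat \<Rightarrow> complex) \<Rightarrow>
    nat \<Rightarrow> int \<Rightarrow> complex \<Rightarrow> complex \<Rightarrow> complex" where
  "correlation_branch A a t p z1 z2 =
     (\<Sum>(m, n, k, l)\<in>A. a (m, n, k, l) * exp (m * log_branch p z1) * exp (n * log_branch p z2)
        * log_branch p z1 ^ k * log_branch p z2 ^ l) / (z1 - z2) ^ t"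

definition converges_to :: "('i \<Rightarrow> complex) \<Rightarrow> complex \<Rightarrow> bool" where
  "converges_to f c \<longleftrightarrow> (\<lambda>i. norm (f i)) summable_on UNIV \<and> (f has_sum c) UNIV"

definition graded_dual ::
  "(complex \<Rightarrow> 'w \<Rightarrow> 'w) \<Rightarrow> ('i \<Rightarrow> 'w::ab_group_add set) \<Rightarrow> ('w \<Rightarrow> complex) set" where
  "graded_dual s C = {w'. Vector_Spaces.linear s (*) w' \<and> finite {i. \<exists>w\<in>C i. w' w \<noteq> 0}}"

text \<open>
  \<open>Wgr h s \<alpha>\<close> is the subspace of weight \<open>h\<close>, fermion number \<open>s\<close> and \<open>g\<close>-weight \<open>[\<alpha>]\<close>,
  where \<open>[\<alpha>]\<close> is given by its representative in \<^const>\<open>strip\<close>.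
\<close>

locale lower_bounded_twisted_module =
  vertex_superalgebra_automorphism sV Vgr YV vac L0V LmV g Sg Ng +
  W: log_operator sW gW SgW NgW
  for sV :: "complex \<Rightarrow> 'v::ab_group_add \<Rightarrow> 'v" and Vgr YV vac L0V LmV g Sg Ng
    and sW :: "complex \<Rightarrow> 'w::ab_group_add \<Rightarrow> 'w" and gW SgW NgW :: "'w \<Rightarrow> 'w" +
  fixes Wgr :: "complex \<Rightarrow> bit \<Rightarrow> complex \<Rightarrow> 'w set"
    and YW :: "('v, 'w) twisted_map"
    and L0W LmW :: "'w \<Rightarrow> 'w"
  assumes W_graded: "graded_space sW (\<lambda>(h, s, \<alpha>). Wgr h s \<alpha>)"
    and W_strip: "\<alpha> \<notin> strip \<Longrightarrow> Wgr h s \<alpha> = {0}"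
    and W_lower_bounded: "\<exists>b. \<forall>h. Re h < b \<longrightarrow> wt_space sW (\<lambda>h s. \<Union>\<alpha>. Wgr h s \<alpha>) h = {0}"
    and gW_linear: "Vector_Spaces.linear sW sW gW"
    and gW_grading: "\<alpha> \<in> strip \<Longrightarrow>
      W.span (\<Union>h. \<Union>s. Wgr h s \<alpha>) = gen_eigenspace sW gW (e2pi \<alpha>)"
    and L0W_linear: "Vector_Spaces.linear sW sW L0W"
    and L0W_grading: "wt_space sW (\<lambda>h s. \<Union>\<alpha>. Wgr h s \<alpha>) h = gen_eigenspace sW L0W h"
    and LmW_linear: "Vector_Spaces.linear sW sW LmW"
    and L0W_LmW: "L0W (LmW w) - LmW (L0W w) = LmW w"
    and YW_linear_left: "Vector_Spaces.linear sV sW (\<lambda>v. YW v n k w)"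
    and YW_linear_right: "Vector_Spaces.linear sW sW (YW v n k)"
    and YW_log_bounded: "\<exists>K. \<forall>n. \<forall>k\<ge>K. YW v n k w = 0"
    and YW_even: "v \<in> par_space sV Vgr s \<Longrightarrow> w \<in> par_space sW (\<lambda>h s. \<Union>\<alpha>. Wgr h s \<alpha>) t \<Longrightarrow>
      YW v n k w \<in> par_space sW (\<lambda>h s. \<Union>\<alpha>. Wgr h s \<alpha>) (s + t)"
    and identity: "YW vac n k w = (if n = -1 \<and> k = 0 then w else 0)"
    and gW_YW: "gW (YW v n k w) = YW (g v) n k (gW w)"
    and L0W_bracket: "L0W (YW v n k w) - YW v n k (L0W w) =
      sW (- n - 1) (YW v n k w) + sW (of_nat (k + 1)) (YW v n (k + 1) w) + YW (L0V v) n k w"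
    and LmW_derivative: "YW (LmV v) n k w =
      sW (- n) (YW v (n - 1) k w) + sW (of_nat (k + 1)) (YW v (n - 1) (k + 1) w)"
    and LmW_bracket: "LmW (YW v n k w) - YW v n k (LmW w) = YW (LmV v) n k w"
    and equivariance: "z \<noteq> 0 \<Longrightarrow> w' \<in> graded_dual sW (\<lambda>(h, s, \<alpha>). Wgr h s \<alpha>) \<Longrightarrow>
      vertex_value YW (p + 1) w' (g v) z w = vertex_value YW p w' v z w"
    and duality: "u \<in> par_space sV Vgr s \<Longrightarrow> v \<in> par_space sV Vgr t \<Longrightarrow>
      w' \<in> graded_dual sW (\<lambda>(h, s, \<alpha>). Wgr h s \<alpha>) \<Longrightarrow>
      \<exists>A a T. finite A \<and> (\<forall>p z1 z2.
        (norm z1 > norm z2 \<and> norm z2 > 0 \<longrightarrow>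
          converges_to (product_terms YW p w' u z1 v z2 w) (correlation_branch A a T p z1 z2)) \<and>
        (norm z2 > norm z1 \<and> norm z1 > 0 \<longrightarrow>
          converges_to (\<lambda>i. koszul s t * product_terms YW p w' v z2 u z1 w i)
            (correlation_branch A a T p z1 z2)) \<and>
        (norm z2 > norm (z1 - z2) \<and> norm (z1 - z2) > 0 \<longrightarrow>
          (\<lambda>i. norm (iterate_terms YV YW p w' u z1 v z2 w i)) summable_on UNIV \<and>
          (\<bar>Arg2pi z1 - Arg2pi z2\<bar> < pi / 2 \<longrightarrow>
            converges_to (iterate_terms YV YW p w' u z1 v z2 w) (correlation_branch A a T p z1 z2))))"

section \<open>Generating fields and generator twist fields\<close>

definition field_monomial ::
  "('i \<Rightarrow> int \<Rightarrow> 'v \<Rightarrow> 'v) \<Rightarrow> 'v \<Rightarrow> ('i \<times> int) list \<Rightarrow> 'v" where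
  "field_monomial \<phi> vac ms = foldr (\<lambda>(i, m). \<phi> i m) ms vac"

locale generating_fields =
  vertex_superalgebra_automorphism sV Vgr YV vac L0V LmV g Sg Ng
  for sV :: "complex \<Rightarrow> 'v::ab_group_add \<Rightarrow> 'v" and Vgr YV vac L0V LmV g Sg Ng +
  fixes I :: "'i set" and \<phi> :: "'i \<Rightarrow> int \<Rightarrow> 'v \<Rightarrow> 'v" and \<alpha> :: "'i \<Rightarrow> complex"
  assumes \<phi>_field: "i \<in> I \<Longrightarrow> \<phi> i n = YV (\<phi> i (-1) vac) n"
    and \<phi>_span: "V.span {field_monomial \<phi> vac ms | ms. fst ` set ms \<subseteq> I} = UNIV"
    and \<phi>_homogeneous: "i \<in> I \<Longrightarrow> \<exists>h s. \<phi> i (-1) vac \<in> Vgr h s"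
    and \<alpha>_weight: "i \<in> I \<Longrightarrow> \<alpha> i \<in> g_weights sV g"
    and \<phi>_gen_eigenspace: "i \<in> I \<Longrightarrow> \<phi> i (-1) vac \<in> gen_eigenspace sV g (e2pi (\<alpha> i))"
    and \<phi>_Ng: "i \<in> I \<Longrightarrow>
      Ng (\<phi> i (-1) vac) = 0 \<or> (\<exists>j\<in>I. Ng (\<phi> i (-1) vac) = \<phi> j (-1) vac)"

context lower_bounded_twisted_module
begin

text \<open>
  The coefficient of \<open>x^(-n-1) (log x)^k\<close> in the twist vertex operator applied to \<open>v\<close>, for
  \<open>w\<close> and \<open>v\<close> homogeneous in fermion number: \<open>q\<close> is the exponent of \<open>x\<close> in
  \<open>exp (x L_W(-1))\<close>, and \<open>(log y)^j = (log x + \<pi> \<i>)^j\<close> is expanded binomially.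
\<close>

definition twist_coeff :: "'w \<Rightarrow> complex \<Rightarrow> nat \<Rightarrow> 'v \<Rightarrow> 'w" where
  "twist_coeff w n k v =
     sW (koszul (parity sV Vgr v) (parity sW (\<lambda>h s. \<Union>\<alpha>. Wgr h s \<alpha>) w))
       (Sum_any (\<lambda>(q::nat, j::nat).
         sW (of_nat (j choose k) * (of_real pi * \<i>) ^ (j - k)
             * exp (of_real pi * \<i> * (- (n + of_nat q) - 1)) / fact q)
           ((LmW ^^ q) (YW v (n + of_nat q) j w))))"

text \<open>The nilpotent part of \<open>L_W(0)\<close>, whose semisimple part is \<open>h\<close> on the subspace of weight \<open>h\<close>.\<close>

definition L0W_nil :: "'w \<Rightarrow> 'w" where
  "L0W_nil w = L0W w -
     Sum_any (\<lambda>(h, s, \<alpha>). sW h (component (\<lambda>(h, s, \<alpha>). Wgr h s \<alpha>) w (h, s, \<alpha>)))"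

definition generated_by :: "'w set \<Rightarrow> bool" where
  "generated_by S \<longleftrightarrow>
     W.span {YW v n k ((LmW ^^ p) ((L0W ^^ q) w)) | v n k p q w. w \<in> S} = UNIV"

end

locale generator_twist_fields =
  lower_bounded_twisted_module sV Vgr YV vac L0V LmV g Sg Ng sW gW SgW NgW Wgr YW L0W LmW
  for sV :: "complex \<Rightarrow> 'v::ab_group_add \<Rightarrow> 'v" and Vgr YV vac L0V LmV g Sg Ng
    and sW :: "complex \<Rightarrow> 'w::ab_group_add \<Rightarrow> 'w" and gW SgW NgW Wgr YW L0W LmW +
  fixes A :: "'a set" and \<psi> :: "'a \<Rightarrow> complex \<Rightarrow> nat \<Rightarrow> 'v \<Rightarrow> 'w"
  assumes \<psi>_linear: "a \<in> A \<Longrightarrow> Vector_Spaces.linear sV sW (\<psi> a n k)"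
    and \<psi>_twist_field: "a \<in> A \<Longrightarrow> v \<in> par_space sV Vgr s \<Longrightarrow>
      \<psi> a n k v = twist_coeff (\<psi> a (-1) 0 vac) n k v"
    and \<psi>_homogeneous: "a \<in> A \<Longrightarrow> \<exists>h s \<beta>. \<psi> a (-1) 0 vac \<in> Wgr h s \<beta>"
    and \<psi>_generate: "generated_by {\<psi> a (-1) 0 vac | a. a \<in> A}"
    and \<psi>_L0W_nil: "a \<in> A \<Longrightarrow>
      L0W_nil (\<psi> a (-1) 0 vac) = 0 \<or> (\<exists>b\<in>A. L0W_nil (\<psi> a (-1) 0 vac) = \<psi> b (-1) 0 vac)"

end

theory Submission
  imports Defs "HOL-Computational_Algebra.Polynomial"
begin

text \<open>
  The module is spanned by the coefficients of \<open>Y(v, y) L(-1)^p L(0)^q w\<close> for generators \<open>w\<close>.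
  The span of the generators is stable under \<open>L(0)\<close>, and \<open>L(-1)\<close> can be moved to the left with its
  bracket formula. A twist field is \<open>exp (x L(-1)) Y(v, y) w\<close> up to sign, so inverting the
  exponential expresses \<open>Y(v, y) w\<close> through \<open>L(-1)\<close>-images of coefficients of twist fields; the span of
  these coefficients is stable under \<open>L(-1)\<close> because \<open>L(-1) \<psi>(x) v = d/dx \<psi>(x) v + \<psi>(x) L(-1) v\<close>.
  Finally, equivariance kills the powers \<open>x^(-n-1)\<close> whose exponents do not match the \<open>g\<close>-weight
  of \<open>v\<close>, and creation kills the monomials whose innermost mode is nonnegative.
\<close>

section \<open>Linear maps and spans\<close>

lemma linear_module_hom: "Vector_Spaces.linear s t f \<Longrightarrow> module_hom s t f"
  by (simp add: Vector_Spaces.linear_def)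

lemma linear_endoI:
  assumes "vector_space s" "\<And>x y. f (x + y) = f x + f y" "\<And>c x. f (s c x) = s c (f x)"
  shows "Vector_Spaces.linear s s f"
  using assms by (simp add: Vector_Spaces.linear_iff)

lemma span_image_subset:
  assumes "Vector_Spaces.linear s t f" "module.subspace t U" "\<And>x. x \<in> B \<Longrightarrow> f x \<in> U"
    "x \<in> module.span s B"
  shows "f x \<in> U"
proof -
  interpret module_hom s t f by (rule linear_module_hom) fact
  have "f x \<in> m2.span (f ` B)"
    unfolding span_image using assms(4) by (rule imageI)
  also have "\<dots> \<subseteq> m2.span U"
    using assms(3) by (intro m2.span_mono) auto
  also have "\<dots> = U"
    using assms(2) by (rule m2.span_eq_iff[THEN iffD2])
  finally show ?thesis .
qed

section \<open>Graded spaces\<close>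

locale graded_vector_space = vector_space scale
  for scale :: "complex \<Rightarrow> 'b::ab_group_add \<Rightarrow> 'b" +
  fixes C :: "'i \<Rightarrow> 'b set"
  assumes C: "graded_space scale C"
begin

lemma decomposes_component:
  shows "decomposes C v (component C v)"
  unfolding component_def using C theI'[of "decomposes C v"] by (simp add: graded_space_def)

lemma component_eqI:
  assumes "decomposes C v f" shows "component C v = f"
  using assms decomposes_component C unfolding graded_space_def by blast

lemma graded_subspace: "subspace (C i)"
  using C by (simp add: graded_space_def)

lemma linear_component:
  shows "Vector_Spaces.linear scale scale (\<lambda>v. component C v i)"
proof -
  have add: "component C (v + w) = (\<lambda>i. component C v i + component C w i)" for v w
  proof (rule component_eqI)
    show "decomposes C (v + w) (\<lambda>i. component C v i + component C w i)"
      using decomposes_component[of v] decomposes_component[of w]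
      by (auto simp: decomposes_def Sum_any.distrib intro!: subspace_add graded_subspace
          intro: finite_subset[of _ "{i. component C v i \<noteq> 0} \<union> {i. component C w i \<noteq> 0}"])
  qed
  have scale: "component C (scale c v) = (\<lambda>i. scale c (component C v i))" for c v
  proof (rule component_eqI)
    have v: "v = sum (component C v) {i. component C v i \<noteq> 0}"
      and fin: "finite {i. component C v i \<noteq> 0}"
      using decomposes_component[of v] by (auto simp: decomposes_def Sum_any.expand_set)
    have "scale c v = (\<Sum>i\<in>{i. component C v i \<noteq> 0}. scale c (component C v i))"
      by (subst v) (simp add: scale_sum_right)
    also have "\<dots> = Sum_any (\<lambda>i. scale c (component C v i))"
      using fin by (intro Sum_any.expand_superset[symmetric]) auto
    finally show "decomposes C (scale c v) (\<lambda>i. scale c (component C v i))"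
      using decomposes_component[of v]
      by (auto simp: decomposes_def intro!: subspace_scale graded_subspace
          intro: finite_subset[of _ "{i. component C v i \<noteq> 0}"])
  qed
  show ?thesis
    by (intro linear_endoI vector_space_axioms) (simp_all add: add scale)
qed

lemma component_homogeneous:
  assumes "v \<in> C i"
  shows "component C v = (\<lambda>j. if j = i then v else 0)"
proof (rule component_eqI)
  have "Sum_any (\<lambda>j. if j = i then v else 0) = (\<Sum>j\<in>{i}. if j = i then v else 0)"
    by (rule Sum_any.expand_superset) auto
  then show "decomposes C v (\<lambda>j. if j = i then v else 0)"
    using assms subspace_0[OF graded_subspace]
    by (auto simp: decomposes_def intro: finite_subset[of _ "{i}"])
qed

lemma component_eq_0:
  assumes "v \<in> span (\<Union>i\<in>J. C i)" "j \<notin> J"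
  shows "component C v j = 0"
proof -
  have "component C v j \<in> {0}"
    using assms(2)
    by (intro span_image_subset[OF linear_component subspace_single_0 _ assms(1)])
      (auto simp: component_homogeneous)
  then show ?thesis by simp
qed

lemma span_graded:
  shows "span (\<Union>i. C i) = UNIV"
proof -
  have "v \<in> span (\<Union>i. C i)" for v
  proof -
    have "v = sum (component C v) {i. component C v i \<noteq> 0}" "\<And>i. component C v i \<in> C i"
      using decomposes_component[of v] by (auto simp: decomposes_def Sum_any.expand_set)
    then have "component C v i \<in> span (\<Union>i. C i)" for i
      by (intro span_base) blast
    then have "sum (component C v) {i. component C v i \<noteq> 0} \<in> span (\<Union>i. C i)"
      by (intro span_sum)
    then show ?thesis
      using \<open>v = _\<close> by simp
  qed
  then show ?thesis by blast
qed

lemma component_nonzero: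
  assumes "v \<noteq> 0"
  obtains i where "component C v i \<noteq> 0"
proof (rule ccontr)
  assume "\<not> thesis"
  then have "component C v = (\<lambda>_. 0)" using that by blast
  then show False
    using decomposes_component[of v] \<open>v \<noteq> 0\<close> by (simp add: decomposes_def)
qed

end

text \<open>The functional reads off one nonzero component of \<open>v\<close>. As it factors
  through a single degree it lies in the graded dual, and the last conclusion records this
  concentration.\<close>

lemma graded_dual_separates:
  assumes "vector_space s" and C: "graded_space s C" and "v \<noteq> 0"
  obtains w' i where "w' \<in> graded_dual s C" "w' v \<noteq> 0" "\<forall>u. component C u i = 0 \<longrightarrow> w' u = 0"
proof -
  interpret V: graded_vector_space s C
    using assms by (simp add: graded_vector_space_def graded_vector_space_axioms_def)
  interpret vector_space_pair s "(*) :: complex \<Rightarrow> complex \<Rightarrow> complex"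
    by unfold_locales (auto simp: algebra_simps)
  obtain i where i: "component C v i \<noteq> 0"
    using V.component_nonzero[OF \<open>v \<noteq> 0\<close>] .
  then have "V.independent {component C v i}" by simp
  from linear_independent_extend[OF this, of "\<lambda>_. 1"]
  obtain f where f: "Vector_Spaces.linear s (*) f" "f (component C v i) = 1" by auto
  interpret f: module_hom s "(*)" f by (rule linear_module_hom) fact
  let ?w = "\<lambda>u. f (component C u i)"
  have "{j. \<exists>w\<in>C j. ?w w \<noteq> 0} \<subseteq> {i}"
    by (auto simp: V.component_homogeneous f.zero split: if_splits)
  moreover have "Vector_Spaces.linear s (*) ?w"
    using Vector_Spaces.linear_compose[OF V.linear_component f(1)] by (simp add: o_def)
  ultimately have "?w \<in> graded_dual s C"
    by (auto simp: graded_dual_def intro: finite_subset)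
  then show ?thesis
    using that[of ?w i] f(2) f.zero by auto
qed

section \<open>Generalized eigenspaces\<close>

text \<open>This closes inductions on the nilpotency order: only the image under
  \<open>f - c\<close> has to be placed.\<close>

lemma gen_eigenspace_step:
  assumes "f x - s c x \<in> gen_eigenspace s f c" shows "x \<in> gen_eigenspace s f c"
proof -
  obtain k where "((\<lambda>u. f u - s c u) ^^ k) (f x - s c x) = 0"
    using assms by (auto simp: gen_eigenspace_def)
  then have "((\<lambda>u. f u - s c u) ^^ Suc k) x = 0"
    by (simp add: funpow_Suc_right del: funpow.simps)
  then show ?thesis unfolding gen_eigenspace_def by blast
qed

lemma linear_funpow:
  "vector_space s \<Longrightarrow> Vector_Spaces.linear s s f \<Longrightarrow> Vector_Spaces.linear s s (f ^^ k)"
  by (induction k) (auto intro: Vector_Spaces.linear_compose vector_space.linear_id simp: id_def[symmetric])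

lemma subspace_gen_eigenspace:
  assumes "vector_space s" "Vector_Spaces.linear s s f"
  shows "module.subspace s (gen_eigenspace s f c)"
proof -
  interpret V: vector_space s by fact
  interpret f: module_hom s s f by (rule linear_module_hom) fact
  let ?D = "\<lambda>u. f u - s c u"
  have "Vector_Spaces.linear s s ?D"
    by (intro linear_endoI V.vector_space_axioms) (auto simp: f.add f.scale V.scale_right_distrib V.scale_right_diff_distrib mult.commute)
  then have D: "module_hom s s (?D ^^ k)" for k
    by (intro linear_module_hom linear_funpow assms)
  \<comment> \<open>Vanishing persists for higher powers, so two vectors can be tested with the sum
    of their exponents.\<close>
  have mono: "(?D ^^ (k + l)) x = 0" if "(?D ^^ l) x = 0" for k l x
    using that by (simp add: funpow_add module_hom.zero[OF D])
  show ?thesis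
  proof (rule V.subspaceI)
    show "0 \<in> gen_eigenspace s f c"
      by (auto simp: gen_eigenspace_def intro: exI[of _ 0])
    show "x + y \<in> gen_eigenspace s f c" if "x \<in> gen_eigenspace s f c" "y \<in> gen_eigenspace s f c" for x y
    proof -
      obtain k l where "(?D ^^ k) x = 0" "(?D ^^ l) y = 0"
        using \<open>x \<in> _\<close> \<open>y \<in> _\<close> by (auto simp: gen_eigenspace_def)
      then have "(?D ^^ (l + k)) (x + y) = 0"
        using mono[of k x l] mono[of l y k] by (simp add: module_hom.add[OF D] add.commute)
      then show ?thesis by (auto simp: gen_eigenspace_def)
    qed
    show "s a x \<in> gen_eigenspace s f c" if "x \<in> gen_eigenspace s f c" for a x
      using that by (auto simp: gen_eigenspace_def module_hom.scale[OF D])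
  qed
qed

section \<open>Homogeneous vectors\<close>

context vertex_superalgebra_automorphism
begin

sublocale VG: graded_vector_space sV "\<lambda>(h, s). Vgr h s"
  by unfold_locales (rule V_graded)

text \<open>Stated through eigenvectors of \<open>L0V\<close>, so that the bracket formula and
  evenness give closure under all modes directly.\<close>

definition homog :: "'v \<Rightarrow> bool" where
  "homog v \<longleftrightarrow> (\<exists>h. L0V v = sV h v) \<and> (\<exists>s. v \<in> par_space sV Vgr s)"

lemma homog_graded:
  assumes "v \<in> Vgr h s" shows "homog v"
proof -
  have "v \<in> wt_space sV Vgr h" "v \<in> par_space sV Vgr s"
    using assms by (auto simp: wt_space_def par_space_def intro!: V.span_base)
  then show ?thesis using L0V_grading by (auto simp: homog_def)
qed

lemma homog_YV:
  assumes "homog u" "homog v" shows "homog (YV u n v)"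
proof -
  obtain h h' s s' where h: "L0V u = sV h u" "L0V v = sV h' v"
      "u \<in> par_space sV Vgr s" "v \<in> par_space sV Vgr s'"
    using assms by (auto simp: homog_def)
  have "L0V (YV u n v) = sV (h + h' - of_int n - 1) (YV u n v)"
    using L0V_bracket[of u n v] h
      module_hom.scale[OF linear_module_hom[OF YV_linear_left], of h u n v]
      module_hom.scale[OF linear_module_hom[OF YV_linear_right], of u n h' v]
    by (simp add: algebra_simps)
  with YV_even[OF h(3,4)] show ?thesis by (auto simp: homog_def)
qed

lemma homog_vac: "homog vac"
  using vac_homogeneous by (rule homog_graded)

lemma homog_LmV:
  assumes "homog v" shows "homog (LmV v)"
proof -
  \<comment> \<open>Through the vacuum, \<open>LmV\<close> is itself a mode, and closure under modes
    applies.\<close>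
  have "LmV v = YV v (-2) vac"
    using LmV_derivative[of v "-1" vac] by (simp add: creation)
  then show ?thesis using homog_YV[OF assms homog_vac] by simp
qed

lemma span_homog: "V.span {v. homog v} = UNIV"
proof -
  have "(\<Union>i. (\<lambda>(h, s). Vgr h s) i) \<subseteq> {v. homog v}"
    by (auto intro: homog_graded)
  then show ?thesis using VG.span_graded V.span_mono[of "\<Union>i. (\<lambda>(h, s). Vgr h s) i"] by (simp add: top.extremum_unique)
qed

text \<open>On each graded piece, which \<open>g\<close> preserves, \<open>L0V\<close> is a scalar;
  these pieces span \<open>V\<close>.\<close>

lemma L0V_g: "L0V (g v) = g (L0V v)"
proof -
  interpret L: module_hom sV sV L0V by (rule linear_module_hom[OF L0V_linear])
  interpret g: module_hom sV sV g by (rule linear_module_hom[OF g_linear])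
  have lin: "Vector_Spaces.linear sV sV (\<lambda>v. L0V (g v) - g (L0V v))"
    by (intro linear_endoI V.vector_space_axioms) (simp_all add: L.add L.scale g.add g.scale V.scale_right_diff_distrib)
  have hom: "L0V (g u) - g (L0V u) \<in> {0}" if mem: "u \<in> (\<Union>i. (\<lambda>(h, s). Vgr h s) i)" for u
  proof -
    obtain h s where u: "u \<in> Vgr h s" using mem by auto
    then have "g u \<in> Vgr h s" using g_grading by blast
    then have "u \<in> wt_space sV Vgr h" "g u \<in> wt_space sV Vgr h"
      using u by (auto simp: wt_space_def intro!: V.span_base)
    then show ?thesis by (simp add: L0V_grading g.scale)
  qed
  have "L0V (g v) - g (L0V v) \<in> {0}"
    using span_image_subset[where x = v, OF lin V.subspace_single_0 hom] VG.span_graded by blast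
  then show ?thesis by simp
qed

text \<open>The identity g(u_n v) - cd u_n v = ((g - c)u)_n (g v) + c u_n ((g - d)v) lowers the
  nilpotency order of one argument in each summand; the induction runs over the sum of the two
  orders.\<close>

lemma gen_eigenspace_YV:
  assumes "u \<in> gen_eigenspace sV g c" "v \<in> gen_eigenspace sV g d"
  shows "YV u n v \<in> gen_eigenspace sV g (c * d)"
proof -
  interpret g: module_hom sV sV g by (rule linear_module_hom[OF g_linear])
  let ?D = "\<lambda>c u. g u - sV c u"
  note sub = subspace_gen_eigenspace[OF V.vector_space_axioms g_linear]
  note [simp] = module_hom.diff[OF linear_module_hom[OF YV_linear_left]]
    module_hom.scale[OF linear_module_hom[OF YV_linear_left]]
    module_hom.zero[OF linear_module_hom[OF YV_linear_left]]
    module_hom.diff[OF linear_module_hom[OF YV_linear_right]]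
    module_hom.scale[OF linear_module_hom[OF YV_linear_right]]
    module_hom.zero[OF linear_module_hom[OF YV_linear_right]]
  \<comment> \<open>Hence \<open>g v\<close> has nilpotency order at most that of \<open>v\<close>,
    and the first summand really has smaller total order.\<close>
  have comm: "(?D d ^^ b) (g v) = g ((?D d ^^ b) v)" for b d v
    by (induction b) (simp_all add: g.diff g.scale)
  have "\<forall>a b u v. N = a + b \<longrightarrow> (?D c ^^ a) u = 0 \<longrightarrow> (?D d ^^ b) v = 0 \<longrightarrow>
      YV u n v \<in> gen_eigenspace sV g (c * d)" for N
  proof (induction N rule: less_induct)
    case (less N)
    show ?case
    proof (intro allI impI)
      fix a b u v
      assume N: "N = a + b" and u: "(?D c ^^ a) u = 0" and v: "(?D d ^^ b) v = 0"
      show "YV u n v \<in> gen_eigenspace sV g (c * d)"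
      proof (cases "u = 0 \<or> v = 0")
        case True
        then show ?thesis using V.subspace_0[OF sub] by auto
      next
        case False
        then obtain a' b' where ab: "a = Suc a'" "b = Suc b'"
          using u v by (metis funpow_0 not0_implies_Suc)
        then have u': "(?D c ^^ a') (?D c u) = 0" and v': "(?D d ^^ b') (?D d v) = 0"
          using u v by (simp_all add: funpow_Suc_right del: funpow.simps)
        have gv: "(?D d ^^ b) (g v) = 0"
          using v by (simp only: comm g.zero)
        have "YV (?D c u) n (g v) \<in> gen_eigenspace sV g (c * d)"
          using less.IH[rule_format, of "a' + b" a' b "?D c u" "g v"] u' gv N ab(1)
          by (simp del: funpow.simps)
        moreover have "YV u n (?D d v) \<in> gen_eigenspace sV g (c * d)"
          using less.IH[rule_format, of "a + b'" a b' u "?D d v"] u v' N ab(2)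
          by (simp del: funpow.simps)
        ultimately have "YV (?D c u) n (g v) + sV c (YV u n (?D d v)) \<in> gen_eigenspace sV g (c * d)"
          using V.subspace_add[OF sub] V.subspace_scale[OF sub] by blast
        also have "YV (?D c u) n (g v) + sV c (YV u n (?D d v)) = g (YV u n v) - sV (c * d) (YV u n v)"
          by (simp add: g_YV V.scale_right_diff_distrib)
        finally show ?thesis by (rule gen_eigenspace_step)
      qed
    qed
  qed
  then show ?thesis using assms unfolding gen_eigenspace_def by blast
qed

end

section \<open>Monomials in the generating fields\<close>

context generating_fields
begin

lemma field_monomial_Cons:
  assumes "i \<in> I"
  shows "field_monomial \<phi> vac ((i, m) # ms) = YV (\<phi> i (-1) vac) m (field_monomial \<phi> vac ms)"
  using \<phi>_field[OF assms, of m] by (simp add: field_monomial_def)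

lemma homog_field_monomial:
  "fst ` set ms \<subseteq> I \<Longrightarrow> homog (field_monomial \<phi> vac ms)"
proof (induction ms)
  case Nil
  then show ?case by (simp add: field_monomial_def homog_vac)
next
  case (Cons x ms)
  obtain i m where x: "x = (i, m)" by force
  obtain h s where "\<phi> i (-1) vac \<in> Vgr h s"
    using \<phi>_homogeneous Cons.prems x by fastforce
  then show ?case
    using Cons x by (auto simp: field_monomial_Cons intro!: homog_YV intro: homog_graded)
qed

lemma field_monomial_gen_eigenspace:
  "fst ` set ms \<subseteq> I \<Longrightarrow>
    field_monomial \<phi> vac ms \<in> gen_eigenspace sV g (e2pi (\<Sum>(i, m)\<leftarrow>ms. \<alpha> i))"
proof (induction ms)
  case Nil
  show ?case
    by (auto simp: field_monomial_def gen_eigenspace_def g_vac intro!: exI[of _ "Suc 0"])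
next
  case (Cons x ms)
  obtain i m where x: "x = (i, m)" by force
  then have i: "i \<in> I" using Cons.prems by auto
  have "YV (\<phi> i (-1) vac) m (field_monomial \<phi> vac ms)
      \<in> gen_eigenspace sV g (e2pi (\<alpha> i) * e2pi (\<Sum>(i, m)\<leftarrow>ms. \<alpha> i))"
    using Cons by (intro gen_eigenspace_YV \<phi>_gen_eigenspace[OF i]) auto
  then show ?case
    by (simp add: x field_monomial_Cons[OF i] exp_add distrib_left)
qed

text \<open>The last mode in the list acts on the vacuum; creation kills it when nonnegative, and
  the outer modes preserve zero.\<close>

lemma field_monomial_eq_0:
  "fst ` set ms \<subseteq> I \<Longrightarrow> ms \<noteq> [] \<Longrightarrow> snd (last ms) \<ge> 0 \<Longrightarrow> field_monomial \<phi> vac ms = 0"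
proof (induction ms)
  case (Cons x ms)
  obtain i m where x: "x = (i, m)" by force
  then have i: "i \<in> I" using Cons.prems by auto
  show ?case
  proof (cases "ms = []")
    case True
    then show ?thesis
      using Cons.prems x i by (simp add: field_monomial_Cons creation) (simp add: field_monomial_def creation)
  next
    case False
    then show ?thesis
      using Cons x i
      by (simp add: field_monomial_Cons module_hom.zero[OF linear_module_hom[OF YV_linear_right]])
  qed
qed simp

end

section \<open>Twisted modules\<close>

context lower_bounded_twisted_module
begin

sublocale WG: graded_vector_space sW "\<lambda>(h, s, \<alpha>). Wgr h s \<alpha>"
  by unfold_locales (rule W_graded)

section \<open>Weights and exponents of twisted modes\<close>

lemmas YW_left = linear_module_hom[OF YW_linear_left]
lemmas YW_right = linear_module_hom[OF YW_linear_right]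
lemmas YW_simps = module_hom.add[OF YW_left] module_hom.diff[OF YW_left] module_hom.scale[OF YW_left]
  module_hom.zero[OF YW_left] module_hom.add[OF YW_right] module_hom.diff[OF YW_right]
  module_hom.scale[OF YW_right] module_hom.zero[OF YW_right]

text \<open>Two obstacles separate a coefficient from its expected weight: the nilpotent part of
  L(0) on \<open>w\<close> and the next logarithmic coefficient. Hence an outer induction on the
  nilpotency order of \<open>w\<close> and an inner downward one on \<open>k\<close>.\<close>

lemma YW_weight:
  assumes v: "L0V v = sV h v" and w: "w \<in> gen_eigenspace sW L0W m"
  shows "YW v n k w \<in> gen_eigenspace sW L0W (h + m - n - 1)"
proof -
  let ?E = "gen_eigenspace sW L0W (h + m - n - 1)"
  let ?D = "\<lambda>u. L0W u - sW m u"
  note sub = subspace_gen_eigenspace[OF W.vector_space_axioms L0W_linear]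
  have "\<forall>w k. (?D ^^ N) w = 0 \<longrightarrow> YW v n k w \<in> ?E" for N
  proof (induction N)
    case 0
    then show ?case using W.subspace_0[OF sub] by (simp add: YW_simps)
  next
    case (Suc N)
    show ?case
    proof (intro allI impI)
      fix w k
      assume "(?D ^^ Suc N) w = 0"
      then have *: "YW v n k (?D w) \<in> ?E" for k
        using Suc by (simp add: funpow_Suc_right del: funpow.simps)
      obtain K where K: "\<And>k. k \<ge> K \<Longrightarrow> YW v n k w = 0"
        using YW_log_bounded by blast
      show "YW v n k w \<in> ?E"
      proof (induction "K - k" arbitrary: k)
        case 0
        then show ?case using K W.subspace_0[OF sub] by simp
      next
        case (Suc d)
        then have IH: "YW v n (k + 1) w \<in> ?E" by simp
        \<comment> \<open>The term at \<open>k + 1\<close> comes from x d/dx acting on (log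
          x)^(k+1).\<close>
        have "L0W (YW v n k w) - sW (h + m - n - 1) (YW v n k w)
            = YW v n k (?D w) + sW (of_nat (k + 1)) (YW v n (k + 1) w)"
          using L0W_bracket[of v n k w] v by (simp add: YW_simps algebra_simps)
        then have "L0W (YW v n k w) - sW (h + m - n - 1) (YW v n k w) \<in> ?E"
          using W.subspace_add[OF sub * W.subspace_scale[OF sub IH]] by simp
        then show ?case by (rule gen_eigenspace_step)
      qed
    qed
  qed
  then show ?thesis using w unfolding gen_eigenspace_def by blast
qed

text \<open>Raising the exponent index by \<open>q\<close> lowers the weight by \<open>q\<close>,
  eventually below the lower bound of \<open>W\<close>.\<close>

lemma YW_truncated:
  assumes "homog v" "w \<in> gen_eigenspace sW L0W m"
  obtains Q where "\<And>q j. q \<ge> Q \<Longrightarrow> YW v (n + of_nat q) j w = 0"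
proof -
  obtain h where h: "L0V v = sV h v" using assms(1) by (auto simp: homog_def)
  obtain b where b: "\<And>h. Re h < b \<Longrightarrow> gen_eigenspace sW L0W h = {0}"
    using W_lower_bounded L0W_grading by auto
  obtain Q :: nat where Q: "Re (h + m - n - 1) - b < Q"
    using reals_Archimedean2 by blast
  show ?thesis
  proof (rule that[of Q])
    fix q j assume "q \<ge> Q"
    then have "Re (h + m - (n + of_nat q) - 1) < b" using Q by simp
    then show "YW v (n + of_nat q) j w = 0"
      using YW_weight[OF h assms(2), of "n + of_nat q" j] b by blast
  qed
qed

text \<open>
  For homogeneous \<open>v\<close>, \<open>w\<close> and a functional on a single weight space only one power of \<open>x\<close> survives,
  so at \<open>z = 1\<close> equivariance becomes a quasi-periodicity of one polynomial in \<open>log x\<close>; comparing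
  leading coefficients gives the claim.
\<close>

lemma YW_eq_0_of_g_weight:
  assumes v: "homog v" "v \<in> gen_eigenspace sV g c" and w: "w \<in> gen_eigenspace sW L0W m"
    and c: "c \<noteq> e2pi n"
  shows "YW v n k w = 0"
proof -
  obtain h where h: "L0V v = sV h v" using v(1) by (auto simp: homog_def)
  let ?D = "\<lambda>u. g u - sV c u"
  let ?C = "\<lambda>(h, s, \<alpha>). Wgr h s \<alpha>"
  \<comment> \<open>Induction on the nilpotency order of \<open>g - c\<close> at \<open>v\<close>:
    the hypothesis applied to \<open>?D v\<close> makes \<open>g v\<close> act as \<open>c v\<close>
    in the coefficients at \<open>n\<close>.\<close>
  have "\<forall>v k. L0V v = sV h v \<longrightarrow> (?D ^^ N) v = 0 \<longrightarrow> YW v n k w = 0" for N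
  proof (induction N)
    case 0
    then show ?case by (simp add: YW_simps)
  next
    case (Suc N)
    show ?case
    proof (intro allI impI, rule ccontr)
      fix v k0
      assume v: "L0V v = sV h v" and N: "(?D ^^ Suc N) v = 0" and nz: "YW v n k0 w \<noteq> 0"
      interpret g: module_hom sV sV g by (rule linear_module_hom[OF g_linear])
      interpret L0: module_hom sV sV L0V by (rule linear_module_hom[OF L0V_linear])
      have gv: "L0V (g v) = sV h (g v)" using v by (simp add: L0V_g g.scale)
      then have "L0V (?D v) = sV h (?D v)"
        using v by (simp add: L0.diff L0.scale V.scale_right_diff_distrib mult.commute)
      then have "YW (?D v) n k w = 0" for k
        using N Suc by (simp add: funpow_Suc_right del: funpow.simps)
      then have gv_eq: "YW (g v) n k w = sW c (YW v n k w)" for k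
        by (simp add: YW_simps)
      obtain w' i where w': "w' \<in> graded_dual sW ?C" "w' (YW v n k0 w) \<noteq> 0"
          "\<forall>u. component ?C u i = 0 \<longrightarrow> w' u = 0"
        using graded_dual_separates[OF W.vector_space_axioms W_graded nz] .
      obtain h0 s0 \<beta>0 where i: "i = (h0, s0, \<beta>0)" by (cases i)
      interpret w': module_hom sW "(*)" w'
        using w'(1) by (auto simp: graded_dual_def intro: linear_module_hom)
      \<comment> \<open>\<open>w'\<close> factors through the component \<open>i\<close>, whose
        weight is \<open>h0\<close>.\<close>
      have weight0: "w' u = 0" if "u \<in> gen_eigenspace sW L0W h'" "h' \<noteq> h0" for u h'
      proof -
        have "(\<Union>t \<alpha>. Wgr h' t \<alpha>) \<subseteq> (\<Union>j\<in>{j. fst j = h'}. ?C j)"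
          by force
        then have "u \<in> W.span (\<Union>j\<in>{j. fst j = h'}. ?C j)"
          using that(1) L0W_grading[of h'] W.span_mono unfolding wt_space_def by blast
        then have "component ?C u i = 0"
          using that(2) i by (intro WG.component_eq_0) auto
        then show ?thesis using w'(3) by blast
      qed
      have h0: "h + m - n - 1 = h0"
        using weight0[OF YW_weight[OF v w]] w'(2) by blast
      have other: "w' (YW u n' k w) = 0" if "n' \<noteq> n" "L0V u = sV h u" for u n' k
        using that h0 by (intro weight0[OF YW_weight[OF that(2) w]]) (auto simp: algebra_simps)
      obtain K where K: "\<And>k. k \<ge> K \<Longrightarrow> YW v n k w = 0"
        using YW_log_bounded by blast
      \<comment> \<open>\<open>P\<close>, evaluated at log x, is the whole coefficient of x^(-n-1)
        in the matrix element of \<open>v\<close>.\<close>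
      define P where "P = (\<Sum>k<K. monom (w' (YW v n k w)) k)"
      have vertex_value: "vertex_value YW p w' u 1 w =
          (\<Sum>k<K. w' (YW u n k w) * term_value p 1 n k)"
        if "L0V u = sV h u" "\<And>k. k \<ge> K \<Longrightarrow> YW u n k w = 0" for u p
      proof -
        have "vertex_value YW p w' u 1 w =
            (\<Sum>(n, k)\<in>{n} \<times> {..<K}. w' (YW u n k w) * term_value p 1 n k)"
          unfolding vertex_value_def
        proof (rule Sum_any.expand_superset)
          show "{a. (case a of (n, k) \<Rightarrow> w' (YW u n k w) * term_value p 1 n k) \<noteq> 0} \<subseteq> {n} \<times> {..<K}"
            using other[OF _ that(1)] that(2) by (force simp: not_less[symmetric])
        qed simp
        then show ?thesis by (simp add: sum.cartesian_product[symmetric])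
      qed
      have log1: "log_branch p 1 = 2 * of_real pi * \<i> * of_int p" for p
        by (simp add: log_branch_def Arg2pi_eq_0[THEN iffD2])
      have valP: "(\<Sum>k<K. w' (YW v n k w) * term_value p 1 n k)
          = exp ((- n - 1) * log_branch p 1) * poly P (log_branch p 1)" for p
        by (simp add: P_def term_value_def poly_sum poly_monom sum_distrib_left algebra_simps)
      have eqv: "c * (exp ((- n - 1) * log_branch (p + 1) 1) * poly P (log_branch (p + 1) 1))
          = exp ((- n - 1) * log_branch p 1) * poly P (log_branch p 1)" for p
        using equivariance[OF _ w'(1), of 1 p v w] vertex_value[OF v K, of p] vertex_value[OF gv, of "p + 1"] K
        by (simp add: gv_eq w'.scale valP[symmetric] sum_distrib_left mult.assoc)
      have exp_shift: "exp ((- n - 1) * log_branch (p + 1) 1)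
          = e2pi (- n) * exp ((- n - 1) * log_branch p 1)" for p
      proof -
        have "(- n - 1) * log_branch (p + 1) 1 =
            2 * of_real pi * \<i> * (- n) + (- n - 1) * log_branch p 1 - 2 * of_real pi * \<i>"
          by (simp add: log1 algebra_simps)
        then show ?thesis by (simp only: exp_add exp_diff exp_two_pi_i div_by_1)
      qed
      have log_shift: "log_branch (p + 1) 1 = log_branch p 1 + 2 * of_real pi * \<i>" for p
        by (simp add: log1 algebra_simps)
      have per: "c * e2pi (- n) * poly P (log_branch p 1 + 2 * of_real pi * \<i>)
          = poly P (log_branch p 1)" for p
      proof -
        have "exp ((- n - 1) * log_branch p 1)
            * (c * e2pi (- n) * poly P (log_branch p 1 + 2 * of_real pi * \<i>))
          = exp ((- n - 1) * log_branch p 1) * poly P (log_branch p 1)"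
          using eqv[of p] unfolding exp_shift unfolding log_shift by (simp only: mult_ac)
        then show ?thesis
          by (simp only: mult_left_cancel[OF exp_not_eq_zero])
      qed
      \<comment> \<open>Every branch of log 1 is a root of \<open>R\<close>, so quasi-periodicity
        holds as a polynomial identity. Translation keeps the leading coefficient, which the factor
        \<open>c * e2pi (- n)\<close>, different from 1, forces to vanish.\<close>
      define R where "R = smult (c * e2pi (- n)) (P \<circ>\<^sub>p [:2 * of_real pi * \<i>, 1:]) - P"
      have "poly R (log_branch p 1) = 0" for p
        using per[of p] by (simp add: R_def poly_pcompose add.commute)
      then have "range (\<lambda>p. log_branch p 1) \<subseteq> {x. poly R x = 0}" by auto
      moreover have "infinite (range (\<lambda>p. log_branch p 1))"
        using finite_imageD[of "\<lambda>p. log_branch p 1" UNIV] infinite_UNIV_int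
        by (auto simp: log1 inj_def)
      ultimately have "R = 0"
        using poly_roots_finite finite_subset by blast
      then have "lead_coeff (smult (c * e2pi (- n)) (P \<circ>\<^sub>p [:2 * of_real pi * \<i>, 1:])) = lead_coeff P"
        by (simp add: R_def)
      then have "c * e2pi (- n) * lead_coeff P = lead_coeff P"
        by (subst (asm) lead_coeff_smult, subst (asm) lead_coeff_comp) simp_all
      moreover have "c * e2pi (- n) \<noteq> 1"
        using c by (simp add: exp_minus field_simps)
      ultimately have "P = 0" by simp
      then have "coeff P k0 = 0" by simp
      moreover have "coeff P k0 = w' (YW v n k0 w)"
        using K[of k0] by (simp add: P_def coeff_sum w'.zero)
      ultimately show False using w'(2) by simp
    qed
  qed
  then show ?thesis using v(2) h unfolding gen_eigenspace_def by blast
qed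

section \<open>Coefficients of twist vertex operators\<close>

lemmas LmW_hom = linear_module_hom[OF LmW_linear]

lemma LmW_funpow_hom: "module_hom sW sW (LmW ^^ q)"
  by (intro linear_module_hom linear_funpow W.vector_space_axioms LmW_linear)

text \<open>
  The coefficients of \<open>Y(v, y) w\<close> after the substitution \<open>log y = log x + \<pi> \<i>\<close>, and of
  \<open>exp (x L(-1)) Y(v, y) w\<close>.
\<close>

definition skew_coeff :: "'w \<Rightarrow> complex \<Rightarrow> nat \<Rightarrow> 'v \<Rightarrow> 'w" where
  "skew_coeff w n k v = Sum_any (\<lambda>j::nat.
     sW (of_nat (j choose k) * (of_real pi * \<i>) ^ (j - k) * exp (of_real pi * \<i> * (- n - 1)))
       (YW v n j w))"

definition twist_sum :: "'w \<Rightarrow> complex \<Rightarrow> nat \<Rightarrow> 'v \<Rightarrow> 'w" where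
  "twist_sum w n k v = Sum_any (\<lambda>q::nat.
     sW (1 / fact q) ((LmW ^^ q) (skew_coeff w (n + of_nat q) k v)))"

lemma skew_coeff_sum:
  assumes "\<And>j. j \<ge> K \<Longrightarrow> YW v n j w = 0"
  shows "skew_coeff w n k v = (\<Sum>j<K.
     sW (of_nat (j choose k) * (of_real pi * \<i>) ^ (j - k) * exp (of_real pi * \<i> * (- n - 1)))
       (YW v n j w))"
  unfolding skew_coeff_def
proof (rule Sum_any.expand_superset)
  show "{j. sW (of_nat (j choose k) * (of_real pi * \<i>) ^ (j - k) * exp (of_real pi * \<i> * (- n - 1)))
       (YW v n j w) \<noteq> 0} \<subseteq> {..<K}"
  proof
    fix j assume "j \<in> {j. sW (of_nat (j choose k) * (of_real pi * \<i>) ^ (j - k)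
        * exp (of_real pi * \<i> * (- n - 1))) (YW v n j w) \<noteq> 0}"
    then have "YW v n j w \<noteq> 0" by auto
    then show "j \<in> {..<K}" using assms[of j] by force
  qed
qed simp

lemma twist_sum_sum:
  assumes "\<And>q j. q \<ge> Q \<Longrightarrow> YW v (n + of_nat q) j w = 0"
  shows "twist_sum w n k v =
    (\<Sum>q<Q. sW (1 / fact q) ((LmW ^^ q) (skew_coeff w (n + of_nat q) k v)))"
  unfolding twist_sum_def
proof (rule Sum_any.expand_superset)
  have "sW (1 / fact q) ((LmW ^^ q) (skew_coeff w (n + of_nat q) k v)) = 0" if "q \<ge> Q" for q
    by (simp add: skew_coeff_def assms[OF that] module_hom.zero[OF LmW_funpow_hom])
  then show "{q. sW (1 / fact q) ((LmW ^^ q) (skew_coeff w (n + of_nat q) k v)) \<noteq> 0} \<subseteq> {..<Q}"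
    using not_less by auto
qed simp

text \<open>Truncation in \<open>q\<close> and in \<open>j\<close> confines the double sum to a
  finite rectangle, where the exponential and the logarithmic substitution can be summed one after
  the other.\<close>

lemma twist_coeff_eq:
  assumes v: "homog v" and w: "w \<in> gen_eigenspace sW L0W m"
  shows "twist_coeff w n k v =
    sW (koszul (parity sV Vgr v) (parity sW (\<lambda>h s. \<Union>\<alpha>. Wgr h s \<alpha>) w)) (twist_sum w n k v)"
proof -
  obtain Q where Q: "\<And>q j. q \<ge> Q \<Longrightarrow> YW v (n + of_nat q) j w = 0"
    using YW_truncated[OF v w, of n] by blast
  obtain K where K: "\<And>n j. j \<ge> K \<Longrightarrow> YW v n j w = 0"
    using YW_log_bounded by blast
  define f where "f = (\<lambda>(q, j). sW (of_nat (j choose k) * (of_real pi * \<i>) ^ (j - k)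
             * exp (of_real pi * \<i> * (- (n + of_nat q) - 1)) / fact q)
           ((LmW ^^ q) (YW v (n + of_nat q) j w)))"
  have "f x = 0" if "x \<notin> {..<Q} \<times> {..<K}" for x
    using that Q K by (cases x) (auto simp: f_def not_less module_hom.zero[OF LmW_funpow_hom])
  then have "{x. f x \<noteq> 0} \<subseteq> {..<Q} \<times> {..<K}"
    by blast
  then have "Sum_any f = sum f ({..<Q} \<times> {..<K})"
    by (intro Sum_any.expand_superset) simp_all
  also have "\<dots> = (\<Sum>q<Q. \<Sum>j<K. f (q, j))"
    by (simp add: sum.cartesian_product)
  also have "\<dots> = (\<Sum>q<Q. sW (1 / fact q) ((LmW ^^ q) (skew_coeff w (n + of_nat q) k v)))"
    by (intro sum.cong refl)
      (simp add: f_def skew_coeff_sum[OF K] module_hom.sum[OF LmW_funpow_hom]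
        module_hom.scale[OF LmW_funpow_hom] W.scale_sum_right)
  also have "\<dots> = twist_sum w n k v"
    using twist_sum_sum[OF Q] by simp
  finally show ?thesis by (simp add: twist_coeff_def f_def)
qed

text \<open>Coefficient form of Y(L(-1)v, y)w = - d/dx Y(v, y)w for y = exp(pi i) x; the sign is
  that of dy = - dx.\<close>

lemma skew_coeff_LmV:
  "skew_coeff w n k (LmV v) =
    sW n (skew_coeff w (n - 1) k v) - sW (of_nat (k + 1)) (skew_coeff w (n - 1) (k + 1) v)"
proof -
  obtain K where K: "\<And>n j. j \<ge> K \<Longrightarrow> YW v n j w = 0"
    using YW_log_bounded by blast
  define c where "c j k = of_nat (j choose k) * (of_real pi * \<i>) ^ (j - k)" for j k
  define e where "e = exp (of_real pi * \<i> * (- n - 1))"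
  have e: "exp (of_real pi * \<i> * (- (n - 1) - 1)) = - e"
  proof -
    have "of_real pi * \<i> * (- (n - 1) - 1) = of_real pi * \<i> * (- n - 1) + of_real pi * \<i>"
      by (simp add: algebra_simps)
    then show ?thesis by (simp only: e_def exp_add exp_pi_i) simp
  qed
  have K0: "YW (LmV v) n j w = 0" if "j \<ge> K" for j
    using K[of j] K[of "j + 1"] that by (simp add: LmW_derivative)
  \<comment> \<open>Differentiating before or after expanding (log x + pi i)^(j+1) gives the same
    coefficient.\<close>
  have c_Suc: "c j k * of_nat (Suc j) = of_nat (Suc k) * c (Suc j) (Suc k)" for j
  proof -
    have "of_nat (j choose k) * of_nat (Suc j) = (of_nat (Suc k) * of_nat (Suc j choose Suc k) :: complex)"
      unfolding of_nat_mult[symmetric] Suc_times_binomial by (simp only: mult.commute)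
    then have "(of_nat (j choose k) * of_nat (Suc j)) * (of_real pi * \<i>) ^ (j - k)
        = (of_nat (Suc k) * of_nat (Suc j choose Suc k)) * (of_real pi * \<i>) ^ (j - k)"
      by (simp only:)
    then show ?thesis
      unfolding c_def diff_Suc_Suc by (simp only: mult_ac)
  qed
  have "(\<Sum>j<K. sW (c j k * of_nat (j + 1)) (YW v (n - 1) (j + 1) w)) =
      (\<Sum>j<K. sW (of_nat (k + 1) * c (Suc j) (k + 1)) (YW v (n - 1) (Suc j) w))"
    unfolding Suc_eq_plus1[symmetric] c_Suc ..
  \<comment> \<open>The added term at 0 vanishes because \<open>0 choose (k + 1)\<close> is 0; the
    top term at \<open>K\<close> then drops out by the bound on logarithms.\<close>
  also have "\<dots> = (\<Sum>j<Suc K. sW (of_nat (k + 1) * c j (k + 1)) (YW v (n - 1) j w))"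
    by (subst sum.lessThan_Suc_shift) (simp add: c_def)
  also have "\<dots> = (\<Sum>j<K. sW (of_nat (k + 1) * c j (k + 1)) (YW v (n - 1) j w))"
    using K[of K] by simp
  finally have shift: "(\<Sum>j<K. sW (c j k * of_nat (j + 1)) (YW v (n - 1) (j + 1) w)) = \<dots>" .
  have "skew_coeff w n k (LmV v) = (\<Sum>j<K. sW (c j k * e) (YW (LmV v) n j w))"
    using skew_coeff_sum[OF K0] by (simp add: c_def e_def)
  also have "\<dots> = (\<Sum>j<K. sW (- n * e) (sW (c j k) (YW v (n - 1) j w)))
      + (\<Sum>j<K. sW e (sW (c j k * of_nat (j + 1)) (YW v (n - 1) (j + 1) w)))"
    by (simp add: LmW_derivative W.scale_right_distrib W.scale_right_diff_distrib sum.distrib[symmetric] mult_ac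
        del: of_nat_add of_nat_Suc)
  also have "\<dots> = sW (- n * e) (\<Sum>j<K. sW (c j k) (YW v (n - 1) j w))
      + sW (of_nat (k + 1) * e) (\<Sum>j<K. sW (c j (k + 1)) (YW v (n - 1) j w))"
    unfolding W.scale_sum_right[symmetric] shift
    by (simp add: W.scale_sum_right mult_ac)
  also have "\<dots> = sW n (skew_coeff w (n - 1) k v)
      - sW (of_nat (k + 1)) (skew_coeff w (n - 1) (k + 1) v)"
  proof -
    have "skew_coeff w (n - 1) k' v = sW (- e) (\<Sum>j<K. sW (c j k') (YW v (n - 1) j w))" for k'
      using skew_coeff_sum[OF K, where n = "n - 1" and k = k']
      unfolding e by (simp add: c_def W.scale_sum_right mult_ac)
    then show ?thesis by simp
  qed
  finally show ?thesis .
qed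

text \<open>This is the product rule for exp(x L(-1)) Y(v, y)w: differentiating the exponential
  gives L(-1), and differentiating Y(v, y)w gives - Y(L(-1)v, y)w.\<close>

lemma LmW_twist_sum:
  assumes v: "homog v" and w: "w \<in> gen_eigenspace sW L0W m"
  shows "LmW (twist_sum w n k v) = sW (- n) (twist_sum w (n - 1) k v)
    + sW (of_nat (k + 1)) (twist_sum w (n - 1) (k + 1) v) + twist_sum w n k (LmV v)"
proof -
  \<comment> \<open>Taken at \<open>n - 1\<close>, one bound truncates all the sums involved,
    including the one for \<open>LmV v\<close>.\<close>
  obtain Q where Q: "\<And>q j. q \<ge> Q \<Longrightarrow> YW v (n - 1 + of_nat q) j w = 0"
    using YW_truncated[OF v w, of "n - 1"] by blast
  have Q1: "YW v (n + of_nat q) j w = 0" if "q \<ge> Q" for q j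
    using Q[of "Suc q" j] that by simp
  have Q2: "YW (LmV v) (n + of_nat q) j w = 0" if "q \<ge> Q" for q j
    using Q[OF that] by (simp add: LmW_derivative algebra_simps)
  define S where "S q k = sW (1 / fact q) ((LmW ^^ q) (skew_coeff w (n - 1 + of_nat q) k v))" for q k
  have "LmW (twist_sum w n k v) = (\<Sum>q<Q. sW (1 / fact q) ((LmW ^^ Suc q) (skew_coeff w (n + of_nat q) k v)))"
    by (simp add: twist_sum_sum[OF Q1] module_hom.sum[OF LmW_hom] module_hom.scale[OF LmW_hom])
  also have "\<dots> = (\<Sum>q<Q. sW (of_nat (Suc q)) (S (Suc q) k))"
  proof (intro sum.cong refl)
    fix q
    have "of_nat (Suc q) * (1 / fact (Suc q)) = (1 / fact q :: complex)"
      unfolding fact_Suc of_nat_mult by (simp del: of_nat_Suc)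
    moreover have "n - 1 + of_nat (Suc q) = n + of_nat q" by simp
    ultimately show "sW (1 / fact q) ((LmW ^^ Suc q) (skew_coeff w (n + of_nat q) k v))
        = sW (of_nat (Suc q)) (S (Suc q) k)"
      unfolding S_def W.scale_scale by simp
  qed
  \<comment> \<open>The new term at 0 carries the factor 0; the term at \<open>Q\<close> is removed
    next by truncation.\<close>
  also have "\<dots> = (\<Sum>q<Suc Q. sW (of_nat q) (S q k))"
    by (subst sum.lessThan_Suc_shift) simp
  also have "\<dots> = (\<Sum>q<Q. sW (of_nat q) (S q k))"
    using Q[of Q] by (simp add: S_def skew_coeff_def module_hom.zero[OF LmW_funpow_hom])
  \<comment> \<open>Writing \<open>q\<close> as \<open>- n + (n + q)\<close> and adding and
    subtracting the logarithmic terms separates d/dx of the whole sum from the expression in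
    \<open>skew_coeff_LmV\<close> at exponent \<open>n + q\<close>.\<close>
  also have "\<dots> = sW (- n) (\<Sum>q<Q. S q k) + sW (of_nat (k + 1)) (\<Sum>q<Q. S q (k + 1))
      + (\<Sum>q<Q. sW (n + of_nat q) (S q k) - sW (of_nat (k + 1)) (S q (k + 1)))"
    by (simp add: W.scale_sum_right[symmetric] sum_subtractf W.scale_left_distrib sum.distrib)
  also have "(\<Sum>q<Q. sW (n + of_nat q) (S q k) - sW (of_nat (k + 1)) (S q (k + 1)))
      = twist_sum w n k (LmV v)"
    unfolding twist_sum_sum[where v = "LmV v" and n = n and w = w and Q = Q and k = k, OF Q2, simplified]
  proof (intro sum.cong refl)
    fix q
    have shift: "n + of_nat q - 1 = n - 1 + of_nat q" by simp
    show "sW (n + of_nat q) (S q k) - sW (of_nat (k + 1)) (S q (k + 1))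
      = sW (1 / fact q) ((LmW ^^ q) (skew_coeff w (n + of_nat q) k (LmV v)))"
      unfolding S_def skew_coeff_LmV shift
      by (simp add: module_hom.diff[OF LmW_funpow_hom] module_hom.scale[OF LmW_funpow_hom]
          W.scale_right_diff_distrib mult_ac)
  qed
  finally show ?thesis
    by (simp add: twist_sum_sum[OF Q] S_def)
qed

lemma homogeneous_gen_eigenspace:
  assumes "w \<in> Wgr h s \<beta>" shows "w \<in> gen_eigenspace sW L0W h"
  using assms unfolding L0W_grading[symmetric] wt_space_def by (intro W.span_base) blast

lemma L0W_homogeneous:
  assumes "w \<in> Wgr h s \<beta>" shows "L0W w = L0W_nil w + sW h w"
proof -
  let ?f = "\<lambda>(h, s, \<alpha>). sW h (component (\<lambda>(h, s, \<alpha>). Wgr h s \<alpha>) w (h, s, \<alpha>))"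
  have comp: "component (\<lambda>(h, s, \<alpha>). Wgr h s \<alpha>) w = (\<lambda>j. if j = (h, s, \<beta>) then w else 0)"
    using assms by (intro WG.component_homogeneous) simp
  have "Sum_any ?f = sum ?f {(h, s, \<beta>)}"
    by (rule Sum_any.expand_superset) (auto simp: comp split: if_splits)
  then show ?thesis by (simp add: L0W_nil_def comp)
qed

end

section \<open>Generation by twist fields\<close>

context generator_twist_fields
begin

abbreviation gen :: "'a \<Rightarrow> 'w" where
  "gen a \<equiv> \<psi> a (-1) 0 vac"

definition twist_span :: "'w set" where
  "twist_span = W.span {\<psi> a n k v | a n k v. a \<in> A \<and> homog v}"

lemma gen_gen_eigenspace:
  assumes "a \<in> A" obtains m where "gen a \<in> gen_eigenspace sW L0W m"
  using \<psi>_homogeneous[OF assms] homogeneous_gen_eigenspace by blast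

lemma subspace_twist_span: "W.subspace twist_span"
  by (simp add: twist_span_def)

lemma koszul_square: "koszul s t * koszul s t = 1"
  by (simp add: koszul_def)

text \<open>The Koszul sign does not depend on \<open>n\<close> and \<open>k\<close> and squares to
  1, so it can be moved to either side.\<close>

lemma \<psi>_twist_sum:
  assumes "a \<in> A" "homog v"
  obtains c where "c * c = 1" "\<And>n k. \<psi> a n k v = sW c (twist_sum (gen a) n k v)"
proof -
  obtain m where "gen a \<in> gen_eigenspace sW L0W m" by (rule gen_gen_eigenspace[OF assms(1)])
  moreover obtain s where "v \<in> par_space sV Vgr s" using assms(2) by (auto simp: homog_def)
  ultimately show ?thesis
    using that[OF koszul_square] \<psi>_twist_field[OF assms(1)] twist_coeff_eq[OF assms(2)] by metis
qed

lemma twist_sum_in_twist_span: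
  assumes "a \<in> A" "homog v" shows "twist_sum (gen a) n k v \<in> twist_span"
proof -
  obtain c where c: "c * c = 1" "\<psi> a n k v = sW c (twist_sum (gen a) n k v)"
    using \<psi>_twist_sum[OF assms] by metis
  then have "twist_sum (gen a) n k v = sW c (\<psi> a n k v)" by simp
  moreover have "\<psi> a n k v \<in> twist_span"
    unfolding twist_span_def using assms by (intro W.span_base) blast
  ultimately show ?thesis
    using W.subspace_scale[OF subspace_twist_span] by simp
qed

lemma LmW_twist_span:
  assumes "x \<in> twist_span" shows "LmW x \<in> twist_span"
proof (rule span_image_subset[OF LmW_linear subspace_twist_span _ assms[unfolded twist_span_def]])
  fix x assume "x \<in> {\<psi> a n k v | a n k v. a \<in> A \<and> homog v}"
  then obtain a n k v where x: "x = \<psi> a n k v" "a \<in> A" "homog v" by blast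
  obtain m where m: "gen a \<in> gen_eigenspace sW L0W m" by (rule gen_gen_eigenspace[OF x(2)])
  have "LmW (twist_sum (gen a) n k v) \<in> twist_span"
    unfolding LmW_twist_sum[OF x(3) m] using x
    by (intro W.subspace_add W.subspace_scale subspace_twist_span twist_sum_in_twist_span homog_LmV)
  moreover obtain c where "x = sW c (twist_sum (gen a) n k v)"
    using \<psi>_twist_sum[OF x(2,3)] x(1) by metis
  ultimately show "LmW x \<in> twist_span"
    by (simp add: module_hom.scale[OF LmW_hom] W.subspace_scale[OF subspace_twist_span])
qed

text \<open>
  The factor \<open>exp (x L(-1))\<close> and the substitution of the logarithm are unipotent, so they can be
  inverted by downward induction on the exponents of \<open>x\<close> and \<open>log x\<close>, which are bounded above.
\<close>

lemma YW_gen_in_twist_span: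
  assumes a: "a \<in> A" shows "YW v n k (gen a) \<in> twist_span"
proof -
  note sub = subspace_twist_span
  obtain m where m: "gen a \<in> gen_eigenspace sW L0W m" by (rule gen_gen_eigenspace[OF a])
  have homog: "YW v n k (gen a) \<in> twist_span" if v: "homog v" for v n k
  proof -
    have skew: "skew_coeff (gen a) n k v \<in> twist_span" for n k
    proof -
      obtain Q where Q: "\<And>q j. q \<ge> Q \<Longrightarrow> YW v (n + of_nat q) j (gen a) = 0"
        using YW_truncated[OF v m, of n] by blast
      have "skew_coeff (gen a) (n + of_nat q) k v \<in> twist_span" for q
      proof (induction "Q - q" arbitrary: q rule: less_induct)
        case less
        show ?case
        proof (cases "q < Q")
          case False
          then show ?thesis
            by (simp add: skew_coeff_def Q W.subspace_0[OF sub])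
        next
          case True
          define t where "t r = sW (1 / fact r) ((LmW ^^ r) (skew_coeff (gen a) (n + of_nat q + of_nat r) k v))" for r
          \<comment> \<open>A range of the form \<open>Suc Q\<close> lets the term at 0, the wanted
            skew coefficient, be split off. The remaining terms have larger exponent index and fall
            under the induction hypothesis.\<close>
          have "twist_sum (gen a) (n + of_nat q) k v = (\<Sum>r<Suc Q. t r)"
            unfolding t_def
          proof (rule twist_sum_sum)
            show "YW v (n + of_nat q + of_nat r) j (gen a) = 0" if "Suc Q \<le> r" for r j
              using Q[of "q + r" j] that by (simp add: add.assoc)
          qed
          also have "\<dots> = t 0 + (\<Sum>r<Q. t (Suc r))"
            by (rule sum.lessThan_Suc_shift)
          finally have "skew_coeff (gen a) (n + of_nat q) k v
              = twist_sum (gen a) (n + of_nat q) k v - (\<Sum>r<Q. t (Suc r))"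
            by (simp add: t_def)
          moreover have "t (Suc r) \<in> twist_span" for r
          proof -
            have "skew_coeff (gen a) (n + of_nat (q + Suc r)) k v \<in> twist_span"
              using True by (intro less) simp
            then have "(LmW ^^ s) (skew_coeff (gen a) (n + of_nat (q + Suc r)) k v) \<in> twist_span" for s
              by (induction s) (auto intro: LmW_twist_span)
            from W.subspace_scale[OF sub this] show ?thesis
              unfolding t_def of_nat_add add.assoc .
          qed
          ultimately show ?thesis
            by (simp add: W.subspace_diff[OF sub] W.subspace_sum[OF sub] twist_sum_in_twist_span a v)
        qed
      qed
      from this[of 0] show ?thesis by simp
    qed
    obtain K where K: "\<And>n k. k \<ge> K \<Longrightarrow> YW v n k (gen a) = 0"
      using YW_log_bounded by blast
    show ?thesis
    proof (induction "K - k" arbitrary: k rule: less_induct)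
      case less
      show ?case
      proof (cases "k < K")
        case False
        then show ?thesis by (simp add: K W.subspace_0[OF sub])
      next
        case True
        let ?e = "exp (of_real pi * \<i> * (- n - 1))"
        let ?t = "\<lambda>j. sW (of_nat (j choose k) * (of_real pi * \<i>) ^ (j - k) * ?e) (YW v n j (gen a))"
        \<comment> \<open>The system is triangular: terms with \<open>j < k\<close> vanish with the
          binomial, those with \<open>j > k\<close> are known by induction, and the diagonal entry
          \<open>?e\<close> is invertible.\<close>
        have "?t j \<in> twist_span" if "j \<in> {..<K} - {k}" for j
        proof (cases "j < k")
          case True
          then show ?thesis by (simp add: W.subspace_0[OF sub] binomial_eq_0)
        next
          case False
          then show ?thesis
            using that \<open>k < K\<close> by (intro W.subspace_scale[OF sub] less) auto
        qed
        then have "sum ?t ({..<K} - {k}) \<in> twist_span" by (rule W.subspace_sum[OF sub])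
        moreover have "skew_coeff (gen a) n k v = sW ?e (YW v n k (gen a)) + sum ?t ({..<K} - {k})"
          using True by (simp add: skew_coeff_sum[OF K] sum.remove[of _ k])
        ultimately have "sW ?e (YW v n k (gen a)) \<in> twist_span"
          using W.subspace_diff[OF sub skew[of n k], of "sum ?t ({..<K} - {k})"] by simp
        from W.subspace_scale[OF sub this, of "inverse ?e"] show ?thesis by simp
      qed
    qed
  qed
  show ?thesis
  proof (rule span_image_subset[OF YW_linear_left sub])
    show "v \<in> V.span {v. homog v}" by (simp add: span_homog)
  qed (use homog in blast)
qed

lemma YW_funpow_in_twist_span:
  assumes a: "a \<in> A" shows "YW v n k ((LmW ^^ p) ((L0W ^^ q) (gen a))) \<in> twist_span"
proof -
  note sub = subspace_twist_span
  \<comment> \<open>On a generator L(0) is the weight plus the nilpotent part, and the latter yields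
    0 or another generator.\<close>
  have L0W: "L0W x \<in> W.span (gen ` A)" if "x \<in> W.span (gen ` A)" for x
  proof (rule span_image_subset[OF L0W_linear _ _ that])
    fix x assume "x \<in> gen ` A"
    then obtain a where x: "x = gen a" "a \<in> A" by blast
    obtain h s \<beta> where "gen a \<in> Wgr h s \<beta>" using \<psi>_homogeneous[OF x(2)] by blast
    then have "L0W x = L0W_nil (gen a) + sW h (gen a)" by (simp add: x L0W_homogeneous)
    moreover have "L0W_nil (gen a) \<in> W.span (gen ` A)"
      using \<psi>_L0W_nil[OF x(2)] W.span_base[of _ "gen ` A"] W.span_zero by auto
    ultimately show "L0W x \<in> W.span (gen ` A)"
      using x by (auto intro!: W.span_add W.span_scale intro: W.span_base)
  qed simp
  have "(L0W ^^ q) (gen a) \<in> W.span (gen ` A)"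
    using a by (induction q) (auto intro: L0W W.span_base)
  then have "YW v n k ((L0W ^^ q) (gen a)) \<in> twist_span" for v n k
    by (rule span_image_subset[OF YW_linear_right sub, rotated]) (auto intro: YW_gen_in_twist_span)
  then show ?thesis
  proof (induction p arbitrary: v n k)
    case (Suc p)
    let ?y = "(LmW ^^ p) ((L0W ^^ q) (gen a))"
    have "YW v n k (LmW ?y) = LmW (YW v n k ?y) - YW (LmV v) n k ?y"
      using LmW_bracket[of v n k ?y] by (simp add: algebra_simps)
    then show ?case
      using Suc by (simp add: W.subspace_diff[OF sub] LmW_twist_span)
  qed simp
qed

lemma twist_span_eq_UNIV: "twist_span = UNIV"
proof -
  have "{YW v n k ((LmW ^^ p) ((L0W ^^ q) w)) | v n k p q w. w \<in> {gen a | a. a \<in> A}} \<subseteq> twist_span"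
    using YW_funpow_in_twist_span by blast
  then have "W.span {YW v n k ((LmW ^^ p) ((L0W ^^ q) w)) | v n k p q w. w \<in> {gen a | a. a \<in> A}}
      \<subseteq> twist_span"
    by (rule W.span_minimal[OF _ subspace_twist_span])
  then show ?thesis
    using \<psi>_generate unfolding generated_by_def by blast
qed

text \<open>The factor exp(x L(-1)) shifts exponents only by integers, so every mode entering this
  coefficient lies in the wrong class modulo the integers.\<close>

lemma \<psi>_eq_0_of_g_weight:
  assumes a: "a \<in> A" and v: "homog v" "v \<in> gen_eigenspace sV g (e2pi \<beta>)" and n: "n - \<beta> \<notin> \<int>"
  shows "\<psi> a n k v = 0"
proof -
  obtain m where m: "gen a \<in> gen_eigenspace sW L0W m" by (rule gen_gen_eigenspace[OF a])
  have "e2pi \<beta> \<noteq> e2pi (n + of_nat q)" for q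
  proof
    assume "e2pi \<beta> = e2pi (n + of_nat q)"
    then obtain j :: int where "2 * of_real pi * \<i> * \<beta> =
        2 * of_real pi * \<i> * (n + of_nat q) + of_int (2 * j) * of_real pi * \<i>"
      unfolding exp_eq by (auto simp: mult_ac)
    then have "(2 * of_real pi * \<i>) * (n - \<beta>) = (2 * of_real pi * \<i>) * (of_int (- j - int q))"
      by (simp add: algebra_simps)
    then have "n - \<beta> = of_int (- j - int q)"
      by (simp only: mult_cancel_left) simp
    then show False using n Ints_of_int by metis
  qed
  then have "YW v (n + of_nat q) j (gen a) = 0" for q j
    using YW_eq_0_of_g_weight[OF v m] by blast
  \<comment> \<open>All modes vanish, so the truncation bound can be taken as 0 and the sum is
    empty.\<close>
  then have "twist_sum (gen a) n k v = 0"
    using twist_sum_sum[of 0 v n "gen a" k] by simp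
  moreover obtain c where "\<psi> a n k v = sW c (twist_sum (gen a) n k v)"
    using \<psi>_twist_sum[OF a v(1)] by metis
  ultimately show ?thesis by simp
qed

end

theorem theorem6p7:
  fixes sV :: "complex \<Rightarrow> 'v::ab_group_add \<Rightarrow> 'v"
    and sW :: "complex \<Rightarrow> 'w::ab_group_add \<Rightarrow> 'w"
    and I :: "'i set" and \<phi> :: "'i \<Rightarrow> int \<Rightarrow> 'v \<Rightarrow> 'v" and \<alpha> :: "'i \<Rightarrow> complex"
    and A :: "'a set" and \<psi> :: "'a \<Rightarrow> complex \<Rightarrow> nat \<Rightarrow> 'v \<Rightarrow> 'w"
  assumes "lower_bounded_twisted_module sV Vgr YV vac L0V LmV g Sg Ng
      sW gW SgW NgW Wgr YW L0W LmW"
    and "generating_fields sV Vgr YV vac L0V LmV g Sg Ng I \<phi> \<alpha>"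
    and "generator_twist_fields sV Vgr YV vac L0V LmV g Sg Ng
      sW gW SgW NgW Wgr YW L0W LmW A \<psi>"
  shows "module.span sW
      {\<psi> a n k (field_monomial \<phi> vac ms) | a n k ms.
         a \<in> A \<and> fst ` set ms \<subseteq> I \<and> n - (\<Sum>(i, m)\<leftarrow>ms. \<alpha> i) \<in> \<int> \<and>
         (ms \<noteq> [] \<longrightarrow> snd (last ms) \<le> -1)} = UNIV"
    (is "module.span sW ?T = UNIV")
proof -
  interpret generating_fields sV Vgr YV vac L0V LmV g Sg Ng I \<phi> \<alpha> by fact
  interpret generator_twist_fields sV Vgr YV vac L0V LmV g Sg Ng
      sW gW SgW NgW Wgr YW L0W LmW A \<psi> by fact
  have monomial: "\<psi> a n k (field_monomial \<phi> vac ms) \<in> W.span ?T"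
    if a: "a \<in> A" and ms: "fst ` set ms \<subseteq> I" for a n k ms
  proof (cases "n - (\<Sum>(i, m)\<leftarrow>ms. \<alpha> i) \<in> \<int> \<and> (ms \<noteq> [] \<longrightarrow> snd (last ms) \<le> -1)")
    case True
    then have "\<psi> a n k (field_monomial \<phi> vac ms) \<in> ?T" using a ms by blast
    then show ?thesis by (rule W.span_base)
  next
    case False
    \<comment> \<open>A monomial outside the listed family contributes zero, by its exponent or by
      its innermost mode, which is nonnegative once it is not at most -1.\<close>
    then have "n - (\<Sum>(i, m)\<leftarrow>ms. \<alpha> i) \<notin> \<int> \<or> field_monomial \<phi> vac ms = 0"
      using field_monomial_eq_0[OF ms] by fastforce
    then have "\<psi> a n k (field_monomial \<phi> vac ms) = 0"
    proof
      assume "n - (\<Sum>(i, m)\<leftarrow>ms. \<alpha> i) \<notin> \<int>"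
      with homog_field_monomial[OF ms] field_monomial_gen_eigenspace[OF ms] show ?thesis
        by (rule \<psi>_eq_0_of_g_weight[OF a])
    next
      assume "field_monomial \<phi> vac ms = 0"
      then show ?thesis
        using module_hom.zero[OF linear_module_hom[OF \<psi>_linear[OF a]]] by simp
    qed
    then show ?thesis by (simp add: W.span_zero)
  qed
  \<comment> \<open>The monomials span \<open>V\<close> and \<open>\<psi> a n k\<close> is linear,
    so the bound passes from monomials to all \<open>v\<close>, in particular to the homogeneous
    ones in \<open>twist_span\<close>.\<close>
  have "\<psi> a n k v \<in> W.span ?T" if "a \<in> A" for a n k v
  proof (rule span_image_subset[OF \<psi>_linear[OF that] W.subspace_span])
    show "v \<in> V.span {field_monomial \<phi> vac ms | ms. fst ` set ms \<subseteq> I}"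
      using \<phi>_span by blast
  qed (use monomial[OF that] in blast)
  then have "twist_span \<subseteq> W.span ?T"
    unfolding twist_span_def by (intro W.span_minimal W.subspace_span) blast
  then show ?thesis using twist_span_eq_UNIV by blast
qed

end
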